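(* The vertex set of every acute triangle and the vertex set of every right-angled triangle (in some Euclidean space) is diameter-Ramsey.
   Context: For a finite set $X$ in a Euclidean space, $\mathrm{diam}(X)$ denotes the largest Euclidean distance between two points of $X$. Two point sets are congruent if there is an isometry of the ambient Euclidean space mapping one onto the other. A finite set $P$ of points in a Euclidean space is called diameter-Ramsey if for every integer $r\ge 2$ there exist an integer $d=d(P,r)$ and a finite set $R\subset\mathbb{R}^d$ with $\mathrm{diam}(R)=\mathrm{diam}(P)$ such that for every coloring of the points of $R$ with $r$ colors there is a monochromatic subset of $R$ congruent to $P$. *)

theory Defs
  imports "HOL-Analysis.Analysis"
begin

text \<open>
  The dimension is existentially quantified in the definition of diameter-Ramsey sets, so it
  cannot be carried by a type. \<open>\<real>\<^sup>n\<close> is the library's \<open>topspace (Euclidean_space n)\<close>, the set of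
  sequences vanishing from index \<open>n\<close> on; hence \<open>\<real>\<^sup>m \<subseteq> \<real>\<^sup>n\<close> for \<open>m \<le> n\<close>. Beware that the library's
  \<open>dist\<close> on type \<open>nat \<Rightarrow> real\<close> is not the Euclidean distance.
\<close>

abbreviation euc :: "nat \<Rightarrow> (nat \<Rightarrow> real) set" where
  "euc n \<equiv> topspace (Euclidean_space n)"

definition euc_dist :: "nat \<Rightarrow> (nat \<Rightarrow> real) \<Rightarrow> (nat \<Rightarrow> real) \<Rightarrow> real" where
  "euc_dist n x y = L2_set (\<lambda>i. x i - y i) {..<n}"

text \<open>Meaningful for finite nonempty sets only.\<close>

definition euc_diam :: "nat \<Rightarrow> (nat \<Rightarrow> real) set \<Rightarrow> real" where
  "euc_diam n X = Max {euc_dist n x y | x y. x \<in> X \<and> y \<in> X}"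

definition euc_isometry :: "nat \<Rightarrow> ((nat \<Rightarrow> real) \<Rightarrow> (nat \<Rightarrow> real)) \<Rightarrow> bool" where
  "euc_isometry n f \<longleftrightarrow> bij_betw f (euc n) (euc n) \<and>
     (\<forall>x\<in>euc n. \<forall>y\<in>euc n. euc_dist n (f x) (f y) = euc_dist n x y)"

definition euc_congruent :: "nat \<Rightarrow> (nat \<Rightarrow> real) set \<Rightarrow> (nat \<Rightarrow> real) set \<Rightarrow> bool" where
  "euc_congruent n P Q \<longleftrightarrow> P \<subseteq> euc n \<and> Q \<subseteq> euc n \<and> (\<exists>f. euc_isometry n f \<and> f ` P = Q)"

text \<open>
  \<open>P\<close> lies in \<open>\<real>\<^sup>k\<close> and \<open>R\<close> in \<open>\<real>\<^sup>d\<close>; their common ambient space for congruence is the larger of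
  the two.
\<close>

definition diameter_Ramsey :: "nat \<Rightarrow> (nat \<Rightarrow> real) set \<Rightarrow> bool" where
  "diameter_Ramsey k P \<longleftrightarrow> finite P \<and> P \<subseteq> euc k \<and>
     (\<forall>r\<ge>2. \<exists>d R. finite R \<and> R \<subseteq> euc d \<and> euc_diam d R = euc_diam k P \<and>
        (\<forall>col :: (nat \<Rightarrow> real) \<Rightarrow> nat. col ` R \<subseteq> {..<r} \<longrightarrow>
           (\<exists>Q\<subseteq>R. (\<exists>c. \<forall>q\<in>Q. col q = c) \<and> euc_congruent (max k d) P Q)))"

definition euc_collinear :: "(nat \<Rightarrow> real) set \<Rightarrow> bool" where
  "euc_collinear S \<longleftrightarrow> (\<exists>p v. \<forall>x\<in>S. \<exists>t. \<forall>i. x i = p i + t * v i)"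

definition triangle :: "nat \<Rightarrow> (nat \<Rightarrow> real) \<Rightarrow> (nat \<Rightarrow> real) \<Rightarrow> (nat \<Rightarrow> real) \<Rightarrow> bool" where
  "triangle n a b c \<longleftrightarrow> a \<in> euc n \<and> b \<in> euc n \<and> c \<in> euc n \<and> \<not> euc_collinear {a, b, c}"

text \<open>The angle at the middle argument; it is used for distinct points only.\<close>

definition euc_angle :: "nat \<Rightarrow> (nat \<Rightarrow> real) \<Rightarrow> (nat \<Rightarrow> real) \<Rightarrow> (nat \<Rightarrow> real) \<Rightarrow> real" where
  "euc_angle n a b c =
     arccos ((\<Sum>i<n. (a i - b i) * (c i - b i)) / (euc_dist n a b * euc_dist n c b))"

definition acute_triangle :: "nat \<Rightarrow> (nat \<Rightarrow> real) \<Rightarrow> (nat \<Rightarrow> real) \<Rightarrow> (nat \<Rightarrow> real) \<Rightarrow> bool" where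
  "acute_triangle n a b c \<longleftrightarrow> triangle n a b c \<and>
     euc_angle n b a c < pi / 2 \<and> euc_angle n a b c < pi / 2 \<and> euc_angle n a c b < pi / 2"

definition right_triangle :: "nat \<Rightarrow> (nat \<Rightarrow> real) \<Rightarrow> (nat \<Rightarrow> real) \<Rightarrow> (nat \<Rightarrow> real) \<Rightarrow> bool" where
  "right_triangle n a b c \<longleftrightarrow> triangle n a b c \<and>
     (euc_angle n b a c = pi / 2 \<or> euc_angle n a b c = pi / 2 \<or> euc_angle n a c b = pi / 2)"

end

theory Submission
  imports Defs
begin

text \<open>
  If the squared side lengths of a triangle satisfy \<open>B, C \<le> A \<le> B + C\<close>, put \<open>t = B + C - A\<close>,
  \<open>u = A - C\<close> and \<open>v = A - B\<close>. These are nonnegative, and \<open>A = t + u + v\<close>, \<open>B = t + u\<close>,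
  \<open>C = t + v\<close>. Hence a product of three regular simplices with squared side lengths \<open>t\<close>, \<open>u\<close>, \<open>v\<close>
  has squared diameter \<open>A\<close> and contains copies of the triangle: the points \<open>(i1, j1, k1)\<close>,
  \<open>(i2, j1, k2)\<close>, \<open>(i3, j2, k1)\<close> form one if \<open>i1, i2, i3\<close> are distinct, \<open>j1 \<noteq> j2\<close> and \<open>k1 \<noteq> k2\<close>.
  If the second simplex is large compared with the first, and the third compared with both, then
  repeated pigeonholing makes such a copy monochromatic. Congruence of two triangles with equal
  sides is realised by three reflections, each moving one vertex into place and fixing those
  already placed.
\<close>

section \<open>Euclidean distance\<close>

lemma euc_dist_squared: "(euc_dist n x y)\<^sup>2 = (\<Sum>i<n. (x i - y i)\<^sup>2)"
  by (simp add: euc_dist_def L2_set_def sum_nonneg)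

lemma euc_dist_nonneg: "0 \<le> euc_dist n x y"
  by (simp add: euc_dist_def)

lemma euc_dist_eq_iff:
  "euc_dist m x y = euc_dist n x' y' \<longleftrightarrow>
     (\<Sum>i<m. (x i - y i)\<^sup>2) = (\<Sum>i<n. (x' i - y' i)\<^sup>2)"
  by (simp add: euc_dist_def L2_set_def)

lemma euc_dist_commute: "euc_dist n x y = euc_dist n y x"
  by (simp add: euc_dist_eq_iff power2_commute)

lemma euc_mono: "k \<le> m \<Longrightarrow> euc k \<subseteq> euc m"
  by (auto simp: topspace_Euclidean_space)

lemma euc_dist_larger_space:
  assumes "x \<in> euc k" "y \<in> euc k" "k \<le> m"
  shows "euc_dist m x y = euc_dist k x y"
proof -
  have "(\<Sum>i<k. (x i - y i)\<^sup>2) = (\<Sum>i<m. (x i - y i)\<^sup>2)"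
    by (rule sum.mono_neutral_left) (use assms in \<open>auto simp: topspace_Euclidean_space\<close>)
  then show ?thesis
    by (simp add: euc_dist_eq_iff)
qed

section \<open>Angles and squared side lengths\<close>

lemma euc_law_of_cosines:
  "(euc_dist n a c)\<^sup>2 = (euc_dist n a b)\<^sup>2 + (euc_dist n c b)\<^sup>2
     - 2 * (\<Sum>i<n. (a i - b i) * (c i - b i))"
  unfolding euc_dist_squared sum_distrib_left sum.distrib[symmetric] sum_subtractf[symmetric]
  by (intro sum.cong refl) (simp add: power2_eq_square algebra_simps)

text \<open>The quotient is the argument of \<open>arccos\<close> in \<open>euc_angle\<close>; this
  bound is what lets \<open>cos (arccos x)\<close> return \<open>x\<close>. A zero denominator is
  covered by \<open>x / 0 = 0\<close>.\<close>

lemma euc_Cauchy_Schwarz: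
  "\<bar>(\<Sum>i<n. (a i - b i) * (c i - b i)) / (euc_dist n a b * euc_dist n c b)\<bar> \<le> 1"
proof -
  have "\<bar>\<Sum>i<n. (a i - b i) * (c i - b i)\<bar> \<le> (\<Sum>i<n. \<bar>a i - b i\<bar> * \<bar>c i - b i\<bar>)"
    using sum_abs[of "\<lambda>i. (a i - b i) * (c i - b i)" "{..<n}"] by (simp add: abs_mult)
  also have "\<dots> \<le> euc_dist n a b * euc_dist n c b"
    unfolding euc_dist_def by (rule L2_set_mult_ineq)
  finally have le: "\<bar>\<Sum>i<n. (a i - b i) * (c i - b i)\<bar> \<le> euc_dist n a b * euc_dist n c b" .
  then have "0 \<le> euc_dist n a b * euc_dist n c b"
    by linarith
  then show ?thesis
    using le by (simp only: abs_divide abs_of_nonneg divide_le_eq_1) auto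
qed

text \<open>With a zero denominator, the quotient in \<open>euc_angle\<close> says nothing about its
  numerator. This recovers the numerator: one factor of each product vanishes.\<close>

lemma sum_mult_zero_if_euc_dist_zero:
  assumes "euc_dist n a b * euc_dist n c b = 0"
  shows "(\<Sum>i<n. (a i - b i) * (c i - b i)) = 0"
proof -
  have "\<forall>i<n. a i - b i = 0 \<or> c i - b i = 0"
    using assms by (auto simp: euc_dist_def L2_set_eq_0_iff)
  then show ?thesis
    by (intro sum.neutral) auto
qed

text \<open>An angle that is at most right has nonnegative cosine, hence nonnegative scalar product,
  which the law of cosines turns into the inequality.\<close>

lemma euc_angle_le_right:
  assumes "euc_angle n a b c \<le> pi / 2"
  shows "(euc_dist n a c)\<^sup>2 \<le> (euc_dist n a b)\<^sup>2 + (euc_dist n c b)\<^sup>2"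
proof -
  let ?s = "\<Sum>i<n. (a i - b i) * (c i - b i)" and ?d = "euc_dist n a b * euc_dist n c b"
  have bd: "\<bar>?s / ?d\<bar> \<le> 1"
    by (rule euc_Cauchy_Schwarz)
  have "0 \<le> cos (arccos (?s / ?d))"
  proof (rule cos_ge_zero)
    have "0 \<le> arccos (?s / ?d)"
      using bd by (intro arccos_lbound) linarith+
    then show "- (pi / 2) \<le> arccos (?s / ?d)"
      using pi_ge_zero by linarith
  qed (use assms in \<open>simp add: euc_angle_def\<close>)
  then have "0 \<le> ?s / ?d"
    using cos_arccos_abs[OF bd] by simp
  moreover have "0 \<le> ?d"
    by (simp add: euc_dist_nonneg)
  ultimately have "0 \<le> ?s"
    using sum_mult_zero_if_euc_dist_zero[of n a b c] by (auto simp: zero_le_divide_iff)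
  then show ?thesis
    by (simp add: euc_law_of_cosines[of n a c b])
qed

lemma euc_Pythagoras:
  assumes "euc_angle n a b c = pi / 2"
  shows "(euc_dist n a c)\<^sup>2 = (euc_dist n a b)\<^sup>2 + (euc_dist n c b)\<^sup>2"
proof -
  let ?s = "\<Sum>i<n. (a i - b i) * (c i - b i)" and ?d = "euc_dist n a b * euc_dist n c b"
  have "?s / ?d = cos (arccos (?s / ?d))"
    using euc_Cauchy_Schwarz by (rule cos_arccos_abs[symmetric])
  also have "\<dots> = 0"
    using assms cos_pi_half by (simp only: euc_angle_def)
  finally have "?s = 0"
    using sum_mult_zero_if_euc_dist_zero[of n a b c] by (auto simp: divide_eq_0_iff)
  then show ?thesis
    by (simp add: euc_law_of_cosines[of n a c b])
qed

section \<open>Congruence of triangles\<close>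

text \<open>Reflection in the perpendicular bisector of \<open>p\<close> and \<open>q\<close>; since \<open>x / 0 = 0\<close>, it is the
  identity for \<open>p = q\<close>.\<close>

definition bisector_reflection ::
    "nat \<Rightarrow> (nat \<Rightarrow> real) \<Rightarrow> (nat \<Rightarrow> real) \<Rightarrow> (nat \<Rightarrow> real) \<Rightarrow> (nat \<Rightarrow> real)" where
  "bisector_reflection n p q x = (\<lambda>i. x i -
     ((\<Sum>j<n. (x j - p j)\<^sup>2) - (\<Sum>j<n. (x j - q j)\<^sup>2)) * (q i - p i) / (\<Sum>j<n. (q j - p j)\<^sup>2))"

text \<open>The squared distance to \<open>p\<close> minus that to \<open>q\<close> is affine in the
  point, since the quadratic terms cancel; its gradient is \<open>2 * (q - p)\<close>.\<close>

lemma bisector_defect_diff: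
  fixes x y p q :: "nat \<Rightarrow> real"
  shows "((\<Sum>j<n. (x j - p j)\<^sup>2) - (\<Sum>j<n. (x j - q j)\<^sup>2))
       - ((\<Sum>j<n. (y j - p j)\<^sup>2) - (\<Sum>j<n. (y j - q j)\<^sup>2))
       = 2 * (\<Sum>j<n. (x j - y j) * (q j - p j))"
  unfolding sum_distrib_left sum_subtractf[symmetric]
  by (intro sum.cong refl) (simp add: power2_eq_square algebra_simps)

lemma bisector_reflection_in_euc:
  assumes "p \<in> euc n" "q \<in> euc n" "x \<in> euc n"
  shows "bisector_reflection n p q x \<in> euc n"
  using assms by (auto simp: topspace_Euclidean_space bisector_reflection_def)

lemma bisector_reflection_dist:
  "euc_dist n (bisector_reflection n p q x) (bisector_reflection n p q y) = euc_dist n x y"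
proof -
  define h where "h = (\<lambda>x::nat \<Rightarrow> real. (\<Sum>j<n. (x j - p j)\<^sup>2) - (\<Sum>j<n. (x j - q j)\<^sup>2))"
  define W where "W = (\<Sum>j<n. (q j - p j)\<^sup>2)"
  define S where "S = (\<Sum>j<n. (x j - y j) * (q j - p j))"
  define k where "k = (h x - h y) / W"
  have hS: "h x - h y = 2 * S"
    unfolding h_def S_def by (rule bisector_defect_diff)
  have "bisector_reflection n p q x i - bisector_reflection n p q y i
      = (x i - y i) - k * (q i - p i)" for i
    by (simp add: bisector_reflection_def k_def h_def W_def algebra_simps
        diff_divide_distrib add_divide_distrib)
  then have "(\<Sum>i<n. (bisector_reflection n p q x i - bisector_reflection n p q y i)\<^sup>2)
      = (\<Sum>i<n. ((x i - y i) - k * (q i - p i))\<^sup>2)"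
    by simp
  also have "\<dots> = (\<Sum>i<n. (x i - y i)\<^sup>2) - 2 * k * S + k\<^sup>2 * W"
    unfolding S_def W_def sum_distrib_left sum_subtractf[symmetric] sum.distrib[symmetric]
    by (intro sum.cong refl) (simp add: power2_eq_square algebra_simps)
  \<comment> \<open>For \<open>W \<noteq> 0\<close>, \<open>k * W = 2 * S\<close> makes the last two
    terms cancel; for \<open>W = 0\<close>, \<open>k = 0\<close> because
    \<open>x / 0 = 0\<close>.\<close>
  also have "\<dots> = (\<Sum>i<n. (x i - y i)\<^sup>2)"
    by (cases "W = 0") (auto simp: k_def hS power2_eq_square field_simps)
  finally show ?thesis
    by (simp add: euc_dist_eq_iff)
qed

text \<open>The reflection reverses the sign of the defect \<open>h\<close>, so the second
  application undoes the displacement of the first.\<close>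

lemma bisector_reflection_involution:
  "bisector_reflection n p q (bisector_reflection n p q x) = x"
proof -
  define h where "h = (\<lambda>x::nat \<Rightarrow> real. (\<Sum>j<n. (x j - p j)\<^sup>2) - (\<Sum>j<n. (x j - q j)\<^sup>2))"
  define W where "W = (\<Sum>j<n. (q j - p j)\<^sup>2)"
  define F where "F = bisector_reflection n p q"
  have F: "F x i = x i - h x * (q i - p i) / W" for x i
    by (simp add: F_def bisector_reflection_def h_def W_def)
  show ?thesis
  proof (cases "W = 0")
    case True
    then show ?thesis
      by (simp add: F[unfolded F_def] fun_eq_iff)
  next
    case False
    have "h x - h (F x) = 2 * (\<Sum>j<n. (x j - F x j) * (q j - p j))"
      unfolding h_def by (rule bisector_defect_diff)
    also have "(\<Sum>j<n. (x j - F x j) * (q j - p j)) = h x / W * W"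
      unfolding F W_def sum_distrib_left
      by (intro sum.cong refl) (simp add: power2_eq_square)
    finally have "h (F x) = - h x"
      using False by simp
    then show ?thesis
      unfolding F_def[symmetric] by (simp add: fun_eq_iff F[of "F x"] F[of x])
  qed
qed

lemma bisector_reflection_isometry:
  assumes "p \<in> euc n" "q \<in> euc n"
  shows "euc_isometry n (bisector_reflection n p q)"
  unfolding euc_isometry_def
proof (intro conjI ballI)
  show "bij_betw (bisector_reflection n p q) (euc n) (euc n)"
    by (rule bij_betw_byWitness[where f' = "bisector_reflection n p q"])
       (auto simp: bisector_reflection_involution intro: bisector_reflection_in_euc[OF assms])
qed (rule bisector_reflection_dist)

lemma bisector_reflection_swap:
  assumes "p \<in> euc n" "q \<in> euc n"
  shows "bisector_reflection n p q p = q"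
proof (cases "p = q")
  case True
  then show ?thesis by (simp add: bisector_reflection_def)
next
  case False
  have "(\<Sum>j<n. (q j - p j)\<^sup>2) \<noteq> 0"
  proof
    assume "(\<Sum>j<n. (q j - p j)\<^sup>2) = 0"
    then have "\<forall>j<n. q j = p j"
      by (auto simp: sum_nonneg_eq_0_iff)
    \<comment> \<open>The sum sees the coordinates below \<open>n\<close>; membership in
      \<open>euc n\<close> makes the others zero.\<close>
    moreover have "\<forall>j\<ge>n. q j = p j"
      using assms by (simp add: topspace_Euclidean_space)
    ultimately show False
      using False by (metis ext not_le)
  qed
  \<comment> \<open>At \<open>p\<close> the defect is minus the denominator, so exactly
    \<open>q - p\<close> is added.\<close>
  then show ?thesis
    by (auto simp: bisector_reflection_def fun_eq_iff power2_commute[of "p _"])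
qed

lemma bisector_reflection_fixes:
  assumes "euc_dist n x p = euc_dist n x q"
  shows "bisector_reflection n p q x = x"
  using assms by (simp add: bisector_reflection_def euc_dist_eq_iff)

lemma euc_isometry_comp:
  assumes "euc_isometry n f" "euc_isometry n g"
  shows "euc_isometry n (g \<circ> f)"
  using assms bij_betw_trans[of f "euc n" "euc n" g "euc n"] bij_betwE[of f "euc n" "euc n"]
  by (auto simp: euc_isometry_def)

lemma euc_congruent_triangles:
  assumes in1: "a \<in> euc n" "b \<in> euc n" "c \<in> euc n"
    and in2: "a' \<in> euc n" "b' \<in> euc n" "c' \<in> euc n"
    and ab: "euc_dist n a b = euc_dist n a' b'"
    and ac: "euc_dist n a c = euc_dist n a' c'"
    and bc: "euc_dist n b c = euc_dist n b' c'"
  shows "euc_congruent n {a, b, c} {a', b', c'}"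
proof -
  define f where "f = bisector_reflection n a a'"
  define g where "g = bisector_reflection n (f b) b'"
  define h where "h = bisector_reflection n (g (f c)) c'"
  note dist = bisector_reflection_dist
  have fi: "f x \<in> euc n" if "x \<in> euc n" for x
    unfolding f_def using in1 in2 that by (intro bisector_reflection_in_euc)
  have gi: "g x \<in> euc n" if "x \<in> euc n" for x
    unfolding g_def using in1 in2 that fi by (intro bisector_reflection_in_euc) auto
  have fa: "f a = a'"
    unfolding f_def using in1 in2 by (intro bisector_reflection_swap)
  \<comment> \<open>As \<open>a'\<close> is the image of \<open>a\<close>, its distance to
    \<open>f b\<close> is that of \<open>a\<close> and \<open>b\<close>, hence that of
    \<open>a'\<close> and \<open>b'\<close>: it lies on the bisector defining \<open>g\<close>. The
    same argument gives \<open>ha\<close> and \<open>hb\<close>.\<close>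
  have ga: "g a' = a'"
    unfolding g_def
  proof (rule bisector_reflection_fixes)
    have "euc_dist n a' (f b) = euc_dist n (f a) (f b)"
      by (simp add: fa)
    then show "euc_dist n a' (f b) = euc_dist n a' b'"
      by (simp add: f_def dist ab)
  qed
  have gb: "g (f b) = b'"
    unfolding g_def using in1 in2 fi by (intro bisector_reflection_swap) auto
  have ha: "h a' = a'"
    unfolding h_def
  proof (rule bisector_reflection_fixes)
    have "euc_dist n a' (g (f c)) = euc_dist n (g (f a)) (g (f c))"
      by (simp add: fa ga)
    then show "euc_dist n a' (g (f c)) = euc_dist n a' c'"
      by (simp add: g_def f_def dist ac)
  qed
  have hb: "h b' = b'"
    unfolding h_def
  proof (rule bisector_reflection_fixes)
    have "euc_dist n b' (g (f c)) = euc_dist n (g (f b)) (g (f c))"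
      by (simp add: gb)
    then show "euc_dist n b' (g (f c)) = euc_dist n b' c'"
      by (simp add: g_def f_def dist bc)
  qed
  have hc: "h (g (f c)) = c'"
    unfolding h_def using in1 in2 fi gi by (intro bisector_reflection_swap) auto
  have "euc_isometry n f" "euc_isometry n g" "euc_isometry n h"
    unfolding f_def g_def h_def
    using in1 in2 fi[unfolded f_def] gi[unfolded g_def f_def]
    by (auto intro!: bisector_reflection_isometry)
  then have "euc_isometry n (h \<circ> (g \<circ> f))"
    by (intro euc_isometry_comp)
  moreover have "(h \<circ> (g \<circ> f)) ` {a, b, c} = {a', b', c'}"
    by (simp add: fa ga ha gb hb hc)
  ultimately show ?thesis
    using in1 in2 unfolding euc_congruent_def by blast
qed

section \<open>Colourings of products\<close>

lemma monochromatic_triple: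
  assumes "r > 0" "\<forall>i<2 * r + 1. f i < r"
  obtains i1 i2 i3 :: nat where "i1 < 2 * r + 1" "i2 < 2 * r + 1" "i3 < 2 * r + 1"
    "i1 \<noteq> i2" "i1 \<noteq> i3" "i2 \<noteq> i3" "f i1 = (f i2 :: nat)" "f i1 = f i3"
proof -
  let ?A = "{..<2 * r + 1}"
  have "\<exists>y\<in>{..<r}. card (f -` {y} \<inter> ?A) * card {..<r} \<ge> card ?A"
    using assms by (intro pigeonhole_card) auto
  then obtain y where "card (f -` {y} \<inter> ?A) * r \<ge> 2 * r + 1"
    by auto
  \<comment> \<open>Colour classes of size at most 2 would cover at most \<open>2 * r\<close> of the
    \<open>2 * r + 1\<close> indices.\<close>
  then have "\<not> card (f -` {y} \<inter> ?A) \<le> 2"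
    by (metis Suc_eq_plus1 mult_le_mono1 not_less_eq_eq)
  then have "3 \<le> card (f -` {y} \<inter> ?A)"
    by simp
  then obtain T where "T \<subseteq> f -` {y} \<inter> ?A" "card T = 3"
    by (rule obtain_subset_with_card_n)
  then show thesis
    using that by (fastforce simp: card_3_iff)
qed

text \<open>A column is a map from \<open>X\<close> to \<open>r\<close> colours, so one column more
  than there are such maps forces a repetition.\<close>

lemma equal_columns:
  fixes X :: "'a set" and r :: nat
  assumes "finite X"
  shows "\<exists>M. \<forall>f :: 'a \<Rightarrow> nat \<Rightarrow> nat. (\<forall>x\<in>X. \<forall>j<M. f x j < r) \<longrightarrow>
    (\<exists>j1<M. \<exists>j2<M. j1 \<noteq> j2 \<and> (\<forall>x\<in>X. f x j1 = f x j2))"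
proof (rule exI[of _ "card (X \<rightarrow>\<^sub>E {..<r}) + 1"], intro allI impI)
  let ?M = "card (X \<rightarrow>\<^sub>E {..<r}) + 1"
  fix f :: "'a \<Rightarrow> nat \<Rightarrow> nat"
  assume f: "\<forall>x\<in>X. \<forall>j<?M. f x j < r"
  \<comment> \<open>Restriction puts the columns into a finite set of extensional functions, where
    equality means agreement on \<open>X\<close>.\<close>
  let ?g = "\<lambda>j. restrict (\<lambda>x. f x j) X"
  have "?g ` {..<?M} \<subseteq> X \<rightarrow>\<^sub>E {..<r}"
    using f by auto
  then have "card (?g ` {..<?M}) \<le> card (X \<rightarrow>\<^sub>E {..<r})"
    using assms by (intro card_mono finite_PiE) auto
  then have "\<not> inj_on ?g {..<?M}"
    by (intro pigeonhole) auto
  then obtain j1 j2 where "j1 < ?M" "j2 < ?M" "j1 \<noteq> j2" "?g j1 = ?g j2"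
    by (auto simp: inj_on_def)
  then show "\<exists>j1<?M. \<exists>j2<?M. j1 \<noteq> j2 \<and> (\<forall>x\<in>X. f x j1 = f x j2)"
    by (metis restrict_apply')
qed

text \<open>The sizes are chosen in the order \<open>L\<close>, \<open>M\<close>, \<open>N\<close>,
  the indices in the reverse order: first two layers \<open>k1\<close>, \<open>k2\<close> coloured
  alike, then two columns \<open>j1\<close>, \<open>j2\<close> coloured alike within layer
  \<open>k1\<close>, and finally three indices of equal colour on the line given by
  \<open>j1\<close> and \<open>k1\<close>.\<close>

lemma monochromatic_box_triangle:
  fixes r :: nat
  assumes "r > 0"
  shows "\<exists>L M N. \<forall>f :: nat \<Rightarrow> nat \<Rightarrow> nat \<Rightarrow> nat. (\<forall>i<L. \<forall>j<M. \<forall>k<N. f i j k < r) \<longrightarrow>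
    (\<exists>i1<L. \<exists>i2<L. \<exists>i3<L. \<exists>j1<M. \<exists>j2<M. \<exists>k1<N. \<exists>k2<N.
      i1 \<noteq> i2 \<and> i1 \<noteq> i3 \<and> i2 \<noteq> i3 \<and> j1 \<noteq> j2 \<and> k1 \<noteq> k2 \<and>
      f i2 j1 k2 = f i1 j1 k1 \<and> f i3 j2 k1 = f i1 j1 k1)"
proof -
  define L where "L = 2 * r + 1"
  obtain M where M: "\<forall>f :: nat \<Rightarrow> nat \<Rightarrow> nat. (\<forall>i\<in>{..<L}. \<forall>j<M. f i j < r) \<longrightarrow>
      (\<exists>j1<M. \<exists>j2<M. j1 \<noteq> j2 \<and> (\<forall>i\<in>{..<L}. f i j1 = f i j2))"
    using equal_columns[of "{..<L}" r] by auto
  obtain N where N: "\<forall>f :: nat \<times> nat \<Rightarrow> nat \<Rightarrow> nat.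
      (\<forall>x\<in>{..<L} \<times> {..<M}. \<forall>k<N. f x k < r) \<longrightarrow>
      (\<exists>k1<N. \<exists>k2<N. k1 \<noteq> k2 \<and> (\<forall>x\<in>{..<L} \<times> {..<M}. f x k1 = f x k2))"
    using equal_columns[OF finite_cartesian_product[OF finite_lessThan finite_lessThan], of L M r]
    by (elim exE) (rule that)
  show ?thesis
  proof (rule exI[of _ L], rule exI[of _ M], rule exI[of _ N], intro allI impI)
    fix f :: "nat \<Rightarrow> nat \<Rightarrow> nat \<Rightarrow> nat"
    assume f: "\<forall>i<L. \<forall>j<M. \<forall>k<N. f i j k < r"
    obtain k1 k2 where k: "k1 < N" "k2 < N" "k1 \<noteq> k2"
      and fk: "\<And>i j. i < L \<Longrightarrow> j < M \<Longrightarrow> f i j k1 = f i j k2"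
      using N[rule_format, of "\<lambda>(i, j) k. f i j k"] f by auto
    obtain j1 j2 where j: "j1 < M" "j2 < M" "j1 \<noteq> j2"
      and fj: "\<And>i. i < L \<Longrightarrow> f i j1 k1 = f i j2 k1"
      using M[rule_format, of "\<lambda>i j. f i j k1"] f k by auto
    obtain i1 i2 i3 where i: "i1 < L" "i2 < L" "i3 < L" "i1 \<noteq> i2" "i1 \<noteq> i3" "i2 \<noteq> i3"
      and fi: "f i1 j1 k1 = f i2 j1 k1" "f i1 j1 k1 = f i3 j1 k1"
      using monochromatic_triple[of r "\<lambda>i. f i j1 k1"] assms f j k unfolding L_def by metis
    \<comment> \<open>Changing \<open>k1\<close> to \<open>k2\<close>, or \<open>j1\<close> to
      \<open>j2\<close> in layer \<open>k1\<close>, preserves the colour.\<close>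
    have "f i2 j1 k2 = f i1 j1 k1" "f i3 j2 k1 = f i1 j1 k1"
      using fi fk[of i2 j1] fj[of i3] i j by auto
    with i j k show "\<exists>i1<L. \<exists>i2<L. \<exists>i3<L. \<exists>j1<M. \<exists>j2<M. \<exists>k1<N. \<exists>k2<N.
      i1 \<noteq> i2 \<and> i1 \<noteq> i3 \<and> i2 \<noteq> i3 \<and> j1 \<noteq> j2 \<and> k1 \<noteq> k2 \<and>
      f i2 j1 k2 = f i1 j1 k1 \<and> f i3 j2 k1 = f i1 j1 k1"
      by blast
  qed
qed

text \<open>Each simplex is spanned by multiples of unit vectors, in its own block of coordinates; the
  factor \<open>1 / 2\<close> makes \<open>t\<close>, \<open>u\<close>, \<open>v\<close> the squared side lengths.\<close>

definition simplex_product_point ::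
    "nat \<Rightarrow> nat \<Rightarrow> real \<Rightarrow> real \<Rightarrow> real \<Rightarrow> nat \<Rightarrow> nat \<Rightarrow> nat \<Rightarrow> (nat \<Rightarrow> real)" where
  "simplex_product_point L M t u v i j k =
     (\<lambda>l. if l = i then sqrt (t / 2) else if l = L + j then sqrt (u / 2)
          else if l = L + M + k then sqrt (v / 2) else 0)"

lemma simplex_product_point_in_euc:
  assumes "i < L" "j < M" "k < N"
  shows "simplex_product_point L M t u v i j k \<in> euc (L + M + N)"
  using assms by (auto simp: simplex_product_point_def topspace_Euclidean_space)

text \<open>Distinct vertices of one simplex differ in exactly two coordinates, each contributing
  half the squared side length. The blocks are disjoint, so the three contributions add up.\<close>

lemma simplex_product_point_dist:
  assumes tuv: "t \<ge> 0" "u \<ge> 0" "v \<ge> 0"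
    and ix: "i < L" "j < M" "k < N" "i' < L" "j' < M" "k' < N"
  shows "euc_dist (L + M + N) (simplex_product_point L M t u v i j k)
       (simplex_product_point L M t u v i' j' k')
     = sqrt ((if i = i' then 0 else t) + (if j = j' then 0 else u) + (if k = k' then 0 else v))"
proof -
  have pt: "(simplex_product_point L M t u v i j k l - simplex_product_point L M t u v i' j' k' l)\<^sup>2
    = (if i = i' then 0 else (if l = i then t / 2 else 0) + (if l = i' then t / 2 else 0))
    + (if j = j' then 0 else (if l = L + j then u / 2 else 0) + (if l = L + j' then u / 2 else 0))
    + (if k = k' then 0 else (if l = L + M + k then v / 2 else 0)
        + (if l = L + M + k' then v / 2 else 0))" for l
  proof -
    consider "l < L" | "L \<le> l" "l < L + M" | "L + M \<le> l"
      by linarith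
    then show ?thesis
      using tuv ix by cases (auto simp: simplex_product_point_def)
  qed
  have "(\<Sum>l<L + M + N. (simplex_product_point L M t u v i j k l
      - simplex_product_point L M t u v i' j' k' l)\<^sup>2)
    = (if i = i' then 0 else t) + (if j = j' then 0 else u) + (if k = k' then 0 else v)"
    unfolding pt sum.distrib using ix by (auto simp: sum.distrib)
  then show ?thesis
    by (simp add: euc_dist_def L2_set_def)
qed

section \<open>Non-obtuse triangles\<close>

lemma euc_diam_eqI:
  assumes "finite X" "x \<in> X" "y \<in> X" "euc_dist n x y = D"
    and "\<And>x y. x \<in> X \<Longrightarrow> y \<in> X \<Longrightarrow> euc_dist n x y \<le> D"
  shows "euc_diam n X = D"
  unfolding euc_diam_def
proof (rule Max_eqI)
  have "{euc_dist n x y | x y. x \<in> X \<and> y \<in> X} = (\<lambda>(x, y). euc_dist n x y) ` (X \<times> X)"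
    by auto
  then show "finite {euc_dist n x y | x y. x \<in> X \<and> y \<in> X}"
    using assms(1) by simp
qed (use assms in auto)

text \<open>Here \<open>A\<close>, \<open>B\<close>, \<open>C\<close> are the squares of the sides
  \<open>bc\<close>, \<open>ac\<close>, \<open>ab\<close>. The three inequalities say that
  \<open>u\<close>, \<open>v\<close> and \<open>t\<close> are nonnegative. The vertices
  \<open>a\<close>, \<open>b\<close>, \<open>c\<close> correspond to the three points of the
  monochromatic triple, in that order.\<close>

lemma diameter_Ramsey_non_obtuse:
  assumes in_euc: "a \<in> euc n" "b \<in> euc n" "c \<in> euc n"
    and ab: "euc_dist n a b \<le> euc_dist n b c"
    and ac: "euc_dist n a c \<le> euc_dist n b c"
    and bc: "(euc_dist n b c)\<^sup>2 \<le> (euc_dist n a b)\<^sup>2 + (euc_dist n a c)\<^sup>2"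
  shows "diameter_Ramsey n {a, b, c}"
  unfolding diameter_Ramsey_def
proof (intro conjI allI impI)
  show "finite {a, b, c}" "{a, b, c} \<subseteq> euc n"
    using in_euc by auto
  fix r :: nat
  assume "r \<ge> 2"
  define t where "t = (euc_dist n a b)\<^sup>2 + (euc_dist n a c)\<^sup>2 - (euc_dist n b c)\<^sup>2"
  define u where "u = (euc_dist n b c)\<^sup>2 - (euc_dist n a b)\<^sup>2"
  define v where "v = (euc_dist n b c)\<^sup>2 - (euc_dist n a c)\<^sup>2"
  have tuv: "t \<ge> 0" "u \<ge> 0" "v \<ge> 0"
    using ab ac bc by (auto simp: t_def u_def v_def euc_dist_nonneg power_mono)
  have sides: "sqrt (t + v) = euc_dist n a b" "sqrt (t + u) = euc_dist n a c"
      "sqrt (t + u + v) = euc_dist n b c"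
    by (simp_all add: t_def u_def v_def euc_dist_nonneg)
  have diam: "euc_diam n {a, b, c} = euc_dist n b c"
  proof (rule euc_diam_eqI)
    show "euc_dist n x y \<le> euc_dist n b c" if "x \<in> {a, b, c}" "y \<in> {a, b, c}" for x y
    proof -
      have "euc_dist n z z = 0" for z
        by (simp add: euc_dist_def L2_set_def)
      then show ?thesis
        using that ab ac euc_dist_nonneg[of n b c] euc_dist_commute[of n] by auto
    qed
  qed auto
  obtain L M N where LMN: "\<forall>f :: nat \<Rightarrow> nat \<Rightarrow> nat \<Rightarrow> nat. (\<forall>i<L. \<forall>j<M. \<forall>k<N. f i j k < r) \<longrightarrow>
    (\<exists>i1<L. \<exists>i2<L. \<exists>i3<L. \<exists>j1<M. \<exists>j2<M. \<exists>k1<N. \<exists>k2<N.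
      i1 \<noteq> i2 \<and> i1 \<noteq> i3 \<and> i2 \<noteq> i3 \<and> j1 \<noteq> j2 \<and> k1 \<noteq> k2 \<and>
      f i2 j1 k2 = f i1 j1 k1 \<and> f i3 j2 k1 = f i1 j1 k1)"
    using monochromatic_box_triangle[OF less_le_trans[OF pos2 \<open>r \<ge> 2\<close>]]
    by (elim exE) (rule that)
  define d where "d = L + M + N"
  define P where "P = simplex_product_point L M t u v"
  define R where "R = (\<lambda>(i, j, k). P i j k) ` ({..<L} \<times> {..<M} \<times> {..<N})"
  have PR: "P i j k \<in> R" if "i < L" "j < M" "k < N" for i j k
    using that unfolding R_def by (intro image_eqI[of _ _ "(i, j, k)"]) auto
  have Pd: "euc_dist d (P i j k) (P i' j' k')
     = sqrt ((if i = i' then 0 else t) + (if j = j' then 0 else u) + (if k = k' then 0 else v))"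
    if "i < L" "j < M" "k < N" "i' < L" "j' < M" "k' < N" for i j k i' j' k'
    unfolding d_def P_def using tuv that by (rule simplex_product_point_dist)
  show "\<exists>d R. finite R \<and> R \<subseteq> euc d \<and> euc_diam d R = euc_diam n {a, b, c} \<and>
        (\<forall>col :: (nat \<Rightarrow> real) \<Rightarrow> nat. col ` R \<subseteq> {..<r} \<longrightarrow>
           (\<exists>Q\<subseteq>R. (\<exists>c. \<forall>q\<in>Q. col q = c) \<and> euc_congruent (max n d) {a, b, c} Q))"
  proof (rule exI[of _ d], rule exI[of _ R], intro conjI allI impI)
    show fin: "finite R"
      by (simp add: R_def)
    show Rd: "R \<subseteq> euc d"
      unfolding R_def P_def d_def using simplex_product_point_in_euc[of _ L _ M _ N] by fastforce
    show "euc_diam d R = euc_diam n {a, b, c}"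
    proof -
      \<comment> \<open>A constant colouring supplies points of \<open>R\<close> that differ in all
        three indices, so the distance \<open>sqrt (t + u + v)\<close> is attained; any other pair
        merely drops nonnegative summands.\<close>
      obtain i2 i3 j1 j2 k1 k2 where "i2 < L" "i3 < L" "j1 < M" "j2 < M" "k1 < N" "k2 < N"
          "i2 \<noteq> i3" "j1 \<noteq> j2" "k1 \<noteq> k2"
        using LMN[rule_format, of "\<lambda>_ _ _. 0"] \<open>r \<ge> 2\<close> by auto
      then have "euc_diam d R = sqrt (t + u + v)"
        using tuv by (intro euc_diam_eqI[of R "P i2 j1 k2" "P i3 j2 k1"] fin PR)
          (auto simp: R_def Pd)
      then show ?thesis
        by (simp add: sides diam)
    qed
    fix col :: "(nat \<Rightarrow> real) \<Rightarrow> nat"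
    assume "col ` R \<subseteq> {..<r}"
    then have "\<forall>i<L. \<forall>j<M. \<forall>k<N. col (P i j k) < r"
      using PR by (simp add: image_subset_iff)
    from LMN[THEN spec, THEN mp, OF this] obtain i1 i2 i3 j1 j2 k1 k2 where
      ix: "i1 < L" "i2 < L" "i3 < L" "j1 < M" "j2 < M" "k1 < N" "k2 < N"
      and ne: "i1 \<noteq> i2" "i1 \<noteq> i3" "i2 \<noteq> i3" "j1 \<noteq> j2" "k1 \<noteq> k2"
      and col: "col (P i2 j1 k2) = col (P i1 j1 k1)" "col (P i3 j2 k1) = col (P i1 j1 k1)"
      by blast
    let ?Q = "{P i1 j1 k1, P i2 j1 k2, P i3 j2 k1}"
    have QR: "?Q \<subseteq> R"
      using ix PR by auto
    have "euc_congruent (max n d) {a, b, c} ?Q"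
    proof (rule euc_congruent_triangles)
      show "a \<in> euc (max n d)" "b \<in> euc (max n d)" "c \<in> euc (max n d)"
        using in_euc euc_mono[OF max.cobounded1, of n d] by blast+
      show "P i1 j1 k1 \<in> euc (max n d)" "P i2 j1 k2 \<in> euc (max n d)" "P i3 j2 k1 \<in> euc (max n d)"
        using QR Rd euc_mono[OF max.cobounded2, of d n] by blast+
      have Qd: "P i1 j1 k1 \<in> euc d" "P i2 j1 k2 \<in> euc d" "P i3 j2 k1 \<in> euc d"
        using QR Rd by auto
      have big: "euc_dist (max n d) x y = euc_dist n x y" if "x \<in> euc n" "y \<in> euc n" for x y
        using that by (intro euc_dist_larger_space) auto
      have bigd: "euc_dist (max n d) x y = euc_dist d x y" if "x \<in> euc d" "y \<in> euc d" for x y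
        using that by (intro euc_dist_larger_space) auto
      show "euc_dist (max n d) a b = euc_dist (max n d) (P i1 j1 k1) (P i2 j1 k2)"
        using ix ne sides by (simp add: big bigd Qd in_euc Pd)
      show "euc_dist (max n d) a c = euc_dist (max n d) (P i1 j1 k1) (P i3 j2 k1)"
        using ix ne sides by (simp add: big bigd Qd in_euc Pd)
      show "euc_dist (max n d) b c = euc_dist (max n d) (P i2 j1 k2) (P i3 j2 k1)"
        using ix ne sides by (simp add: big bigd Qd in_euc Pd)
    qed
    moreover have "\<exists>c. \<forall>q\<in>?Q. col q = c"
      using col by auto
    ultimately show "\<exists>Q\<subseteq>R. (\<exists>c. \<forall>q\<in>Q. col q = c) \<and> euc_congruent (max n d) {a, b, c} Q"
      using QR by blast
  qed
qed

text \<open>This is the case \<open>t = 0\<close>: by Pythagoras the hypotenuse is the longest side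
  and the non-obtuse inequality is an equality.\<close>

lemma diameter_Ramsey_right_angle:
  assumes "a \<in> euc n" "b \<in> euc n" "c \<in> euc n" "euc_angle n b a c = pi / 2"
  shows "diameter_Ramsey n {a, b, c}"
proof (rule diameter_Ramsey_non_obtuse)
  have P: "(euc_dist n b c)\<^sup>2 = (euc_dist n a b)\<^sup>2 + (euc_dist n a c)\<^sup>2"
    using euc_Pythagoras[OF assms(4)] by (simp add: euc_dist_commute)
  then show "(euc_dist n b c)\<^sup>2 \<le> (euc_dist n a b)\<^sup>2 + (euc_dist n a c)\<^sup>2"
    by simp
  show "euc_dist n a b \<le> euc_dist n b c" "euc_dist n a c \<le> euc_dist n b c"
    using P by (auto intro: power2_le_imp_le simp: euc_dist_nonneg)
qed (use assms in auto)

lemma diameter_Ramsey_angles_le_right: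
  assumes "a \<in> euc n" "b \<in> euc n" "c \<in> euc n"
    and "euc_angle n b a c \<le> pi / 2" "euc_angle n a b c \<le> pi / 2" "euc_angle n a c b \<le> pi / 2"
  shows "diameter_Ramsey n {a, b, c}"
proof -
  let ?d = "euc_dist n"
  note law = assms(4-6)[THEN euc_angle_le_right]
  have comm: "?d b a = ?d a b" "?d c a = ?d a c" "?d c b = ?d b c"
    by (rule euc_dist_commute)+
  \<comment> \<open>The cases distinguish which side is longest; the vertex opposite to it is then
    listed first.\<close>
  consider "?d a b \<le> ?d b c" "?d a c \<le> ?d b c" | "?d a b \<le> ?d a c" "?d b c \<le> ?d a c"
    | "?d a c \<le> ?d a b" "?d b c \<le> ?d a b"
    by linarith
  then show ?thesis
  proof cases
    case 1
    then show ?thesis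
      using law assms(1-3) comm by (intro diameter_Ramsey_non_obtuse) auto
  next
    case 2
    then have "diameter_Ramsey n {b, a, c}"
      using law assms(1-3) comm by (intro diameter_Ramsey_non_obtuse) auto
    then show ?thesis
      by (simp add: insert_commute)
  next
    case 3
    then have "diameter_Ramsey n {c, a, b}"
      using law assms(1-3) comm by (intro diameter_Ramsey_non_obtuse) auto
    then show ?thesis
      by (simp add: insert_commute)
  qed
qed

theorem theorem3:
  fixes n :: nat and a b c :: "nat \<Rightarrow> real"
  shows "(acute_triangle n a b c \<longrightarrow> diameter_Ramsey n {a, b, c}) \<and>
         (right_triangle n a b c \<longrightarrow> diameter_Ramsey n {a, b, c})"
proof (intro conjI impI)
  assume "acute_triangle n a b c"
  then show "diameter_Ramsey n {a, b, c}"
    by (intro diameter_Ramsey_angles_le_right) (auto simp: acute_triangle_def triangle_def)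
next
  assume R: "right_triangle n a b c"
  then have "a \<in> euc n" "b \<in> euc n" "c \<in> euc n"
    by (auto simp: right_triangle_def triangle_def)
  \<comment> \<open>One instance for each possible vertex of the right angle; the vertex set does
    not depend on the order.\<close>
  then show "diameter_Ramsey n {a, b, c}"
    using R diameter_Ramsey_right_angle[of a n b c] diameter_Ramsey_right_angle[of b n a c]
      diameter_Ramsey_right_angle[of c n a b]
    by (auto simp: right_triangle_def insert_commute)
qed

end
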